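(* For every integer $n\geq 3$, $$ \Upsilon(n)>(n-1)\log\log n+c_8(n-1)-\frac{n}{\log n}-\frac{16381\,n}{5000\log^2 n}-\frac{6n}{\log^3 n}-\frac{54281\,n}{800\log^4 n}-c_{10}\log n. $$
   Context: Here $\log$ is the natural logarithm and $\log^k x$ means $(\log x)^k$. For a positive integer $n$ and a prime $p$, $v_p(n!)$ denotes the exponent of $p$ in the prime factorization of $n!$, and $$\Upsilon(n)=\sum_{p\leq n}v_p(n!),$$ the sum being over primes $p\le n$. The exponential integral is $\mathrm{Ei}(a,z)=\int_1^\infty e^{-tz}t^{-a}\,dt$ for $\Re(z)>0$. The constant $c_8$ is $c_8=c_5+c_7+\mathcal{E}\approx -11.86870152$, where $$c_5=\frac{8337\log^2 2-3965\log 2-1586}{600\log^3 2}\approx -1.645482755,$$ $$c_6=\int_2^{e}\frac{1200x^3-7565x^2-2744x-407}{1200(x-1)^4\log x}\,dx\approx -8.600279758,$$ $$c_7=c_6-\left(\frac{1513}{240}\mathrm{Ei}(1,1)+\frac{343}{150}\mathrm{Ei}(1,2)+\frac{407}{1200}\mathrm{Ei}(1,3)\right)\approx -10.09955739,$$ $$\mathcal{E}=-\frac{29\,(131874\log^2 29-238693\log 29-155428)}{3292800\log^3 29}\approx -0.1236613745.$$ The constant $c_{10}$ is $$c_{10}=\frac{3193\cdot 2}{2400\log 2}+\frac{3193\cdot 2}{2400\log^2 2}+\frac{793\cdot 2}{1200\log^3 2}+\frac{793\cdot 2}{400\log^4 2}\approx 30.52238614.$$ *)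

theory Defs
  imports "HOL-Analysis.Analysis" "HOL-Computational_Algebra.Primes"
begin

definition Upsilon :: "nat \<Rightarrow> nat" where
  "Upsilon n = (\<Sum>p \<in> {p. prime p \<and> p \<le> n}. multiplicity p (fact n :: nat))"

text \<open>
  The generalized exponential integral, for real order \<open>a\<close> and real or complex \<open>z\<close>.
  The integral converges absolutely when the real part of \<open>z\<close> is positive; where it does
  not converge, the value is the library's default for divergent integrals.
\<close>

definition Ei :: "real \<Rightarrow> 'a \<Rightarrow> 'a :: {real_normed_field, banach}" where
  "Ei a z = integral {1..} (\<lambda>t::real. exp (- (of_real t * z)) * of_real (t powr (- a)))"

definition c5 :: real where
  "c5 = (8337 * ln 2 ^ 2 - 3965 * ln 2 - 1586) / (600 * ln 2 ^ 3)"

definition c6 :: real where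
  "c6 = integral {2..exp 1}
     (\<lambda>x::real. (1200 * x ^ 3 - 7565 * x ^ 2 - 2744 * x - 407) / (1200 * (x - 1) ^ 4 * ln x))"

definition c7 :: real where
  "c7 = c6 - (1513 / 240 * Ei 1 1 + 343 / 150 * Ei 1 2 + 407 / 1200 * Ei 1 3)"

text \<open>The calligraphic constant \<open>E\<close> occurring in \<open>c8\<close>.\<close>

definition cE :: real where
  "cE = - (29 * (131874 * ln 29 ^ 2 - 238693 * ln 29 - 155428) / (3292800 * ln 29 ^ 3))"

definition c8 :: real where
  "c8 = c5 + c7 + cE"

definition c10 :: real where
  "c10 = 3193 * 2 / (2400 * ln 2) + 3193 * 2 / (2400 * ln 2 ^ 2)
       + 793 * 2 / (1200 * ln 2 ^ 3) + 793 * 2 / (400 * ln 2 ^ 4)"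

end

theory Submission
  imports Defs "HOL-Computational_Algebra.Squarefree"
begin

text \<open>
  The size of the constants makes the inequality much weaker than the true order of growth
  \<open>\<Upsilon>(n) = n log log n + O(n)\<close>: with \<open>c\<^sub>8\<close> near \<open>-11.87\<close>, any elementary bound
  \<open>\<Upsilon>(n) \<ge> n log log n - C n\<close> with a moderate \<open>C\<close> suffices.

  Since \<open>v\<^sub>p(n!) \<ge> \<lfloor>n/p\<rfloor> > n/p - 1\<close>, and there are at most \<open>n - 1\<close> primes up to \<open>n\<close>, the
  quantity \<open>\<Upsilon>(n)\<close> is at least \<open>n \<Sum>1/p - (n - 1)\<close>.  The sum of prime reciprocals is
  bounded below by Euler's argument (lemma \<open>ln_ln_le_sum_inverse_primes\<close>): writing each
  \<open>m \<le> n\<close> as a squarefree number times a square gives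
  \<open>\<Sum>1/m \<le> \<Prod>(1 + 1/p) \<cdot> \<Sum>1/k\<^sup>2\<close>, where the harmonic sum exceeds \<open>log n\<close>, the product is at
  most \<open>exp (\<Sum>1/p)\<close>, and the sum of inverse squares is at most \<open>5/3 \<le> exp (11/20)\<close>.
  Altogether \<open>\<Upsilon>(n) \<ge> n log log n - (31/20) n + 1\<close>.

  For the constant \<open>c\<^sub>8\<close>, the estimate \<open>c\<^sub>8 \<le> -157/100\<close> is enough (lemma \<open>c8_le\<close>).
  Each of \<open>c\<^sub>7\<close> and \<open>\<E>\<close> is nonpositive for reasons of sign, and
  \<open>c\<^sub>5 \<le> -157/100\<close> follows from \<open>log 2 \<le> 25/36\<close>.  Because \<open>157/100\<close> exceeds \<open>31/20\<close>, the
  comparison holds for large \<open>n\<close>; for small \<open>n\<close> the term \<open>n / log n \<ge> 1\<close> closes the gap.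
\<close>

section \<open>Reciprocals of primes\<close>

text \<open>
  The telescoping comparison \<open>1/k\<^sup>2 \<le> 1/(k - 1/2) - 1/(k + 1/2)\<close>, started at \<open>k = 2\<close>,
  gives \<open>1 + 2/3\<close>; starting it at \<open>k = 1\<close> would only give \<open>2\<close>.
\<close>

lemma sum_inverse_squares_le:
  "(\<Sum>k = 1..n. 1 / real k ^ 2) \<le> 5 / 3"
proof -
  have telescope: "(\<Sum>k = 1..n. 1 / real k ^ 2) \<le> 5 / 3 - 1 / (real n + 1 / 2)" if "n \<ge> 1" for n :: nat
    using that
  proof (induction n rule: dec_induct)
    case base
    show ?case by simp
  next
    case (step n)
    have "1 / real (Suc n) ^ 2 \<le> 1 / (real n + 1 / 2) - 1 / (real (Suc n) + 1 / 2)"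
      by (simp add: divide_simps power2_eq_square) (simp add: algebra_simps)
    with step.IH show ?case by simp
  qed
  show ?thesis
  proof (cases "n \<ge> 1")
    case True
    moreover have "1 / (real n + 1 / 2) \<ge> 0" by simp
    ultimately show ?thesis
      using telescope[of n] by linarith
  qed (simp add: not_le)
qed

lemma squarefree_nat_eq_prod_prime_factors:
  fixes n :: nat
  assumes "squarefree n"
  shows "n = \<Prod>(prime_factors n)"
proof -
  have "n \<noteq> 0" using assms by (metis not_squarefree_0)
  then have "n = (\<Prod>p\<in>prime_factors n. p ^ multiplicity p n)"
    by (simp add: prod_prime_factors)
  also have "\<dots> = \<Prod>(prime_factors n)"
  proof (rule prod.cong)
    fix p assume "p \<in> prime_factors n"
    then have "prime p" "multiplicity p n > 0"
      by (auto simp: prime_factors_multiplicity)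
    moreover from this have "multiplicity p n \<le> 1"
      using assms \<open>n \<noteq> 0\<close> by (auto simp: squarefree_factorial_semiring'')
    ultimately have "multiplicity p n = 1" by linarith
    then show "p ^ multiplicity p n = p" by simp
  qed simp
  finally show ?thesis .
qed

text \<open>
  The pairs (set of primes \<open>S\<close>, integer \<open>k\<close>) index the terms of the expanded right-hand side;
  \<open>m\<close> is sent to the pair with \<open>m = (\<Prod>S) k\<^sup>2\<close>, so the left-hand side is a sum over some of them.
\<close>

lemma harm_le_prod_primes_times_squares:
  "harm n \<le> (\<Prod>p | prime p \<and> p \<le> n. 1 + 1 / real p) * (\<Sum>k = 1..n. 1 / real k ^ 2)"
proof -
  define P where "P = {p. prime p \<and> p \<le> n}"
  define f where "f = (\<lambda>(S, k::nat). (\<Prod>p\<in>S. 1 / real p) * (1 / real k ^ 2))"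
  define g where "g = (\<lambda>m::nat. (prime_factors (squarefree_part m), square_part m))"
  have finP: "finite P" unfolding P_def by simp
  have decomp: "m = \<Prod>(fst (g m)) * snd (g m) ^ 2" for m
    using squarefree_decompose[of m]
      squarefree_nat_eq_prod_prime_factors[OF squarefree_squarefree_part, of m]
    by (simp add: g_def)
  have inj: "inj_on g {1..n}"
    by (rule inj_on_inverseI[where g = "\<lambda>(S, k). \<Prod>S * k ^ 2"])
      (use decomp in \<open>auto simp: case_prod_beta\<close>)
  have image: "g ` {1..n} \<subseteq> Pow P \<times> {1..n}"
  proof -
    have "g m \<in> Pow P \<times> {1..n}" if m: "1 \<le> m" "m \<le> n" for m
    proof -
      have "squarefree_part m dvd m" "square_part m dvd m"
        using squarefree_decompose[of m] by (metis dvd_triv_left)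
          (metis dvd_square_part_iff dvd_refl dvd_trans dvd_triv_left power2_eq_square)
      with m have "square_part m \<le> n" "square_part m \<ge> 1"
          "\<And>p. p \<in> prime_factors (squarefree_part m) \<Longrightarrow> prime p \<and> p \<le> n"
        by (auto dest!: dvd_imp_le simp: Suc_le_eq in_prime_factors_iff 
            dest: dvd_trans intro: Nat.gr0I)
      then show ?thesis by (auto simp: g_def P_def)
    qed
    then show ?thesis by (simp add: image_subset_iff)
  qed
  have "harm n = (\<Sum>m = 1..n. f (g m))"
    unfolding harm_def
  proof (rule sum.cong)
    fix m :: nat
    have "inverse (real m) = 1 / real (\<Prod>(fst (g m)) * snd (g m) ^ 2)"
      by (simp flip: decomp add: inverse_eq_divide)
    then show "inverse (of_nat m) = f (g m)"
      by (simp add: f_def case_prod_beta prod_dividef)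
  qed simp
  also have "\<dots> = sum f (g ` {1..n})"
    by (simp only: sum.reindex[OF inj] o_def)
  also have "\<dots> \<le> sum f (Pow P \<times> {1..n})"
    by (rule sum_mono2[OF _ image]) (auto simp: finP f_def intro!: prod_nonneg divide_nonneg_nonneg)
  also have "\<dots> = (\<Sum>S\<in>Pow P. \<Prod>p\<in>S. 1 / real p) * (\<Sum>k = 1..n. 1 / real k ^ 2)"
    unfolding f_def sum_product by (simp add: sum.cartesian_product)
  also have "(\<Sum>S\<in>Pow P. \<Prod>p\<in>S. 1 / real p) = (\<Prod>p\<in>P. 1 / real p + 1)"
    by (simp add: prod_add finP)
  finally show ?thesis
    by (simp add: P_def add.commute)
qed

text \<open>Euler's proof that the sum of the reciprocals of the primes diverges, made quantitative.\<close>

lemma ln_ln_le_sum_inverse_primes: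
  fixes n :: nat
  assumes "n \<ge> 2"
  shows "ln (ln (real n)) - 11 / 20 \<le> (\<Sum>p | prime p \<and> p \<le> n. 1 / real p)"
    (is "_ \<le> ?S")
proof -
  have "ln (real n) \<le> ln (real n + 1)" using assms by simp
  also have "\<dots> \<le> harm n" by (rule ln_le_harm)
  also have "\<dots> \<le> (\<Prod>p | prime p \<and> p \<le> n. 1 + 1 / real p) * (\<Sum>k = 1..n. 1 / real k ^ 2)"
    by (rule harm_le_prod_primes_times_squares)
  also have "\<dots> \<le> exp ?S * exp (11 / 20)"
  proof (rule mult_mono)
    have "(\<Prod>p | prime p \<and> p \<le> n. 1 + 1 / real p) \<le> (\<Prod>p | prime p \<and> p \<le> n. exp (1 / real p))"
      by (intro prod_mono) (auto intro: add_nonneg_nonneg)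
    then show "(\<Prod>p | prime p \<and> p \<le> n. 1 + 1 / real p) \<le> exp ?S"
      by (simp add: exp_sum)
    have "5 / 3 \<le> exp (11 / 20 :: real)"
      using exp_lower_Taylor_quadratic[of "11 / 20"] by (simp add: power2_eq_square)
    then show "(\<Sum>k = 1..n. 1 / real k ^ 2) \<le> exp (11 / 20)"
      using sum_inverse_squares_le[of n] by linarith
  qed (auto intro: sum_nonneg)
  finally have "ln (real n) \<le> exp (?S + 11 / 20)"
    by (simp add: exp_add)
  moreover have "ln (real n) > 0" using assms by simp
  ultimately have "ln (ln (real n)) \<le> ?S + 11 / 20"
    by (metis ln_exp ln_mono exp_gt_zero)
  then show ?thesis by simp
qed

section \<open>A lower bound in terms of prime reciprocals\<close>

lemma div_le_multiplicity_fact: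
  fixes p n :: nat
  assumes "prime p"
  shows "n div p \<le> multiplicity p (fact n :: nat)"
proof (induction n)
  case (Suc n)
  have "multiplicity p (fact (Suc n) :: nat) = multiplicity p (Suc n) + multiplicity p (fact n :: nat)"
    using assms by (simp add: prime_elem_multiplicity_mult_distrib del: mult_Suc)
  moreover have "p dvd Suc n \<Longrightarrow> multiplicity p (Suc n) \<ge> 1"
    using assms by (intro multiplicity_geI) auto
  ultimately show ?case
    using Suc by (auto simp: div_Suc dvd_eq_mod_eq_0)
qed simp

text \<open>
  Legendre's sum \<open>\<lfloor>n/p\<rfloor> + \<lfloor>n/p\<^sup>2\<rfloor> + \<dots>\<close> is cut after its first term, and each rounding loses less
  than \<open>1\<close>.  Both losses are linear in \<open>n\<close> and so do not touch the leading term \<open>n log log n\<close>.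
\<close>

lemma Upsilon_ge:
  fixes n :: nat
  assumes "n \<ge> 2"
  shows "real n * ln (ln (real n)) - 31 / 20 * real n + 1 \<le> real (Upsilon n)"
proof -
  define P where "P = {p. prime p \<and> p \<le> n}"
  have "P \<subseteq> {2..n}"
    by (auto simp: P_def prime_ge_2_nat)
  then have "card P \<le> n - 1"
    using card_mono[of "{2..n}" P] by simp
  with assms have card: "real (card P) \<le> real n - 1" by linarith
  have "real n * (ln (ln (real n)) - 11 / 20) \<le> real n * (\<Sum>p\<in>P. 1 / real p)"
    unfolding P_def using ln_ln_le_sum_inverse_primes[OF assms] by (intro mult_left_mono) auto
  also have "\<dots> - real (card P) = (\<Sum>p\<in>P. real n / real p - 1)"
    by (simp add: sum_subtractf sum_distrib_left)
  also have "\<dots> \<le> (\<Sum>p\<in>P. real (multiplicity p (fact n :: nat)))"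
  proof (rule sum_mono)
    fix p assume "p \<in> P"
    then have p: "prime p" by (simp add: P_def)
    have "real n / real p - 1 \<le> real (n div p)"
      by (metis diff_le_eq add.commute floor_divide_of_nat_eq of_int_of_nat_eq
          real_of_int_floor_add_one_ge)
    also have "\<dots> \<le> real (multiplicity p (fact n :: nat))"
      using div_le_multiplicity_fact[OF p] by simp
    finally show "real n / real p - 1 \<le> real (multiplicity p (fact n :: nat))" .
  qed
  also have "\<dots> = real (Upsilon n)"
    by (simp add: Upsilon_def P_def)
  finally show ?thesis
    using card by (simp add: algebra_simps)
qed

section \<open>The constants\<close>

text \<open>
  The bounds \<open>log 2 \<le> 25/36\<close> and \<open>c\<^sub>5 \<approx> -1.645\<close> leave a margin for \<open>-157/100\<close>, and this value
  in turn has to lie below \<open>-31/20\<close>, the linear coefficient in \<open>Upsilon_ge\<close>.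
\<close>

lemma c5_le: "c5 \<le> - 157 / 100"
proof -
  define L where "L = ln (2::real)"
  have L: "2 / 3 \<le> L" "L \<le> 25 / 36"
    using ln2_ge_two_thirds ln2_le_25_over_36 by (simp_all add: L_def)
  have sq: "L ^ 2 \<le> 25 / 36 * L"
    using L by (simp add: power2_eq_square mult_right_mono)
  have "L ^ 3 \<le> (25 / 36) ^ 3"
    using L by (intro power_mono) auto
  with sq have "8337 * L ^ 2 - 3965 * L - 1586 \<le> - 157 / 100 * (600 * L ^ 3)"
    using L by (simp add: power3_eq_cube)
  moreover have "600 * L ^ 3 > 0" using L by simp
  ultimately show ?thesis
    unfolding c5_def L_def[symmetric] by (subst pos_divide_le_eq)
qed

text \<open>A divergent integral has value \<open>0\<close>, so the sign of the integrand alone decides.\<close>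

lemma integral_nonneg_real:
  fixes f :: "'a::euclidean_space \<Rightarrow> real"
  assumes "\<And>x. x \<in> S \<Longrightarrow> f x \<ge> 0"
  shows "integral S f \<ge> 0"
  using assms integral_nonneg[of f S] not_integrable_integral[of f S]
  by (cases "f integrable_on S") auto

lemma c6_le_0: "c6 \<le> 0"
proof -
  define f where "f = (\<lambda>x::real.
    (1200 * x ^ 3 - 7565 * x ^ 2 - 2744 * x - 407) / (1200 * (x - 1) ^ 4 * ln x))"
  have "- f x \<ge> 0" if "x \<in> {2..exp 1}" for x :: real
  proof -
    have x: "2 \<le> x" "x \<le> 3"
      using that exp_le by auto
    \<comment> \<open>On this short interval the quadratic term \<open>-7565 x\<^sup>2\<close> dominates the cubic one.\<close>
    then have "x ^ 3 \<le> 3 * x ^ 2"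
      by (simp add: power3_eq_cube power2_eq_square mult_right_mono)
    moreover have "x ^ 2 \<ge> 0" by simp
    ultimately have "1200 * x ^ 3 - 7565 * x ^ 2 - 2744 * x - 407 \<le> 0"
      using x by linarith
    moreover have "1200 * (x - 1) ^ 4 * ln x \<ge> 0" using x by simp
    ultimately show ?thesis
      unfolding f_def using divide_nonpos_nonneg by fastforce
  qed
  then have "integral {2..exp 1} (\<lambda>x. - f x) \<ge> 0"
    by (rule integral_nonneg_real)
  then show ?thesis
    unfolding c6_def f_def[symmetric] by simp
qed

lemma Ei_nonneg: "Ei a (z::real) \<ge> 0"
  unfolding Ei_def by (rule integral_nonneg_real) simp

lemma cE_le_0: "cE \<le> 0"
proof -
  define l where "l = ln (29::real)"
  have "exp 1 ^ 3 \<le> (3 :: real) ^ 3"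
    using exp_le by (intro power_mono) auto
  then have "exp 3 \<le> (29 :: real)"
    by (simp flip: exp_of_nat_mult)
  then have l: "l \<ge> 3" unfolding l_def by (subst ln_ge_iff) auto
  then have "3 * l \<le> l ^ 2" by (simp add: power2_eq_square mult_right_mono)
  then have "0 \<le> 131874 * l ^ 2 - 238693 * l - 155428" using l by linarith
  then show ?thesis using l unfolding cE_def l_def[symmetric] by simp
qed

lemma c8_le: "c8 \<le> - 157 / 100"
proof -
  have "c7 \<le> 0"
    using c6_le_0 Ei_nonneg[of 1 1] Ei_nonneg[of 1 2] Ei_nonneg[of 1 3] by (simp add: c7_def)
  then show ?thesis
    using c5_le cE_le_0 by (simp add: c8_def)
qed

section \<open>The inequality\<close>

theorem theorem1p4:
  fixes n :: nat
  assumes "n \<ge> 3"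
  shows "real (Upsilon n) >
      (real n - 1) * ln (ln (real n)) + c8 * (real n - 1)
      - real n / ln (real n)
      - 16381 * real n / (5000 * ln (real n) ^ 2)
      - 6 * real n / ln (real n) ^ 3
      - 54281 * real n / (800 * ln (real n) ^ 4)
      - c10 * ln (real n)"
proof -
  define x where "x = real n"
  have x: "x \<ge> 3" using assms by (simp add: x_def)
  have ln_ge: "ln x \<ge> 1"
    using x exp_le by (subst ln_ge_iff) auto
  have "ln x \<le> x"
    using x ln_bound by simp
  with ln_ge have main: "x / ln x \<ge> 1"
    using x by (simp add: le_divide_eq)
  have rest: "16381 * x / (5000 * ln x ^ 2) \<ge> 0" "6 * x / ln x ^ 3 \<ge> 0"
    "54281 * x / (800 * ln x ^ 4) \<ge> 0"
    using x ln_ge by simp_all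
  have "c10 \<ge> 0" by (simp add: c10_def)
  then have c10: "c10 * ln x \<ge> 0" using ln_ge by simp
  define y where "y = ln (ln x)"
  have "c8 * (x - 1) \<le> - 157 / 100 * (x - 1)"
    using c8_le x by (intro mult_right_mono) auto
  then have "c8 * (x - 1) \<le> 157 / 100 - 157 / 100 * x"
    by (simp add: field_simps)
  moreover have "x * y - 31 / 20 * x + 1 \<le> real (Upsilon n)"
    using Upsilon_ge[of n] assms by (simp add: x_def y_def)
  moreover have "(x - 1) * y \<le> x * y"
    using ln_ge by (intro mult_right_mono) (auto simp: y_def)
  ultimately have "(x - 1) * y + c8 * (x - 1) - x / ln x < real (Upsilon n)"
    using main x by linarith
  with rest c10 y_def have "(x - 1) * ln (ln x) + c8 * (x - 1) - x / ln x
      - 16381 * x / (5000 * ln x ^ 2) - 6 * x / ln x ^ 3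
      - 54281 * x / (800 * ln x ^ 4) - c10 * ln x < real (Upsilon n)"
    by (smt (verit))
  then show ?thesis by (simp only: x_def)
qed

end
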